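(* Let $k, n$ be positive integers. A function $f : [k]^n \rightarrow \overline{\mathbb{R}}$ admits a $k$-submodular relaxation if and only if $\theta(x, y, z) \in \mathrm{dom}\, f$ for all $x, y, z \in \mathrm{dom}\, f$.
   Context: Notation: $[k] := \{1,2,\dots,k\}$, $[0,k] := \{0,1,\dots,k\}$, $\overline{\mathbb{R}} := \mathbb{R} \cup \{+\infty\}$, with $a < +\infty$ and $a + \infty = +\infty$ for $a \in \mathbb{R}$ (and $(+\infty)+(+\infty)=+\infty$). For a function $f : D^n \to \overline{\mathbb{R}}$, $\mathrm{dom}\, f := \{x \in D^n \mid f(x) < +\infty\}$. Binary operations $\sqcap, \sqcup$ on $[0,k]^n$ are defined componentwise: $(x \sqcap y)_i := x_i$ if $x_i = y_i$, and $0$ if $x_i \neq y_i$; $(x \sqcup y)_i := x_i$ if $x_i = y_i$, $0$ if $0 \neq x_i \neq y_i \neq 0$, $y_i$ if $x_i = 0$, and $x_i$ if $y_i = 0$. A function $g : [0,k]^n \to \overline{\mathbb{R}}$ is $k$-submodular if $g(x) + g(y) \geq g(x \sqcap y) + g(x \sqcup y)$ for all $x, y \in [0,k]^n$ (the inequality holds trivially if $g(x) = +\infty$ or $g(y) = +\infty$). A $k$-submodular relaxation of $f : [k]^n \to \overline{\mathbb{R}}$ is a $k$-submodular function $g : [0,k]^n \to \overline{\mathbb{R}}$ whose restriction to $[k]^n$ equals $f$. The ternary operation $\theta : [k]^3 \to [k]$ is defined by $\theta(a,b,c) := a$ if $a = b$, and $\theta(a,b,c) := c$ if $a \neq b$.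 It is extended to $([k]^n)^3 \to [k]^n$ componentwise: $(\theta(x,y,z))_i = \theta(x_i,y_i,z_i)$. *)

theory Defs
  imports "HOL-Library.FuncSet" "HOL-Library.Extended_Real"
begin

(* The codomain is the reals together with +infinity; ereal also contains -infinity. *)
definition Rbar :: "ereal set" where
  "Rbar = range ereal \<union> {\<infinity>}"

text \<open>
  Elements of \<open>D\<^sup>n\<close> are the functions in \<open>{1..n} \<rightarrow>\<^sub>E D\<close>; functions on them are only
  considered there, their values on other arguments being irrelevant.
\<close>

definition cube :: "nat \<Rightarrow> nat \<Rightarrow> (nat \<Rightarrow> nat) set" where
  "cube k n = {1..n} \<rightarrow>\<^sub>E {1..k}"

definition cube0 :: "nat \<Rightarrow> nat \<Rightarrow> (nat \<Rightarrow> nat) set" where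
  "cube0 k n = {1..n} \<rightarrow>\<^sub>E {0..k}"

definition meet :: "nat \<Rightarrow> (nat \<Rightarrow> nat) \<Rightarrow> (nat \<Rightarrow> nat) \<Rightarrow> (nat \<Rightarrow> nat)" where
  "meet n x y = (\<lambda>i\<in>{1..n}. if x i = y i then x i else 0)"

definition join :: "nat \<Rightarrow> (nat \<Rightarrow> nat) \<Rightarrow> (nat \<Rightarrow> nat) \<Rightarrow> (nat \<Rightarrow> nat)" where
  "join n x y = (\<lambda>i\<in>{1..n}.
     if x i = y i then x i
     else if x i \<noteq> 0 \<and> y i \<noteq> 0 then 0
     else if x i = 0 then y i
     else x i)"

definition k_submodular :: "nat \<Rightarrow> nat \<Rightarrow> ((nat \<Rightarrow> nat) \<Rightarrow> ereal) \<Rightarrow> bool" where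
  "k_submodular k n g \<longleftrightarrow>
     g \<in> cube0 k n \<rightarrow> Rbar \<and>
     (\<forall>x\<in>cube0 k n. \<forall>y\<in>cube0 k n. g x + g y \<ge> g (meet n x y) + g (join n x y))"

definition k_submodular_relaxation ::
  "nat \<Rightarrow> nat \<Rightarrow> ((nat \<Rightarrow> nat) \<Rightarrow> ereal) \<Rightarrow> ((nat \<Rightarrow> nat) \<Rightarrow> ereal) \<Rightarrow> bool" where
  "k_submodular_relaxation k n f g \<longleftrightarrow>
     k_submodular k n g \<and> (\<forall>x\<in>cube k n. g x = f x)"

definition eff_dom :: "nat \<Rightarrow> nat \<Rightarrow> ((nat \<Rightarrow> nat) \<Rightarrow> ereal) \<Rightarrow> (nat \<Rightarrow> nat) set" where
  "eff_dom k n f = {x \<in> cube k n. f x < \<infinity>}"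

definition theta1 :: "nat \<Rightarrow> nat \<Rightarrow> nat \<Rightarrow> nat" where
  "theta1 a b c = (if a = b then a else c)"

definition theta ::
  "nat \<Rightarrow> (nat \<Rightarrow> nat) \<Rightarrow> (nat \<Rightarrow> nat) \<Rightarrow> (nat \<Rightarrow> nat) \<Rightarrow> (nat \<Rightarrow> nat)" where
  "theta n x y z = (\<lambda>i\<in>{1..n}. theta1 (x i) (y i) (z i))"

end

theory Submission imports Defs begin

text \<open>
  If \<open>g\<close> relaxes \<open>f\<close>, then \<open>\<theta>(x, y, z) = ((x \<sqinter> y) \<squnion> z) \<squnion> (x \<sqinter> y)\<close> on \<open>[k]\<^sup>n\<close>, and the
  effective domain of \<open>g\<close> is closed under \<open>\<sqinter>\<close> and \<open>\<squnion>\<close>. Conversely, let \<open>D = dom f\<close> be nonempty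
  and closed under \<open>\<theta>\<close>, and let \<open>S\<close> consist of the partial vectors \<open>s\<close> such that overwriting any
  \<open>z \<in> D\<close> by the nonzero entries of \<open>s\<close> stays in \<open>D\<close>. Then \<open>S\<close> is closed under \<open>\<sqinter>\<close> and \<open>\<squnion>\<close>, and
  its members without zeros are exactly those of \<open>D\<close>. On \<open>S\<close> take \<open>f\<close> (extended by \<open>0\<close>) minus
  \<open>C \<zeta>(s)\<^sup>2\<close>, where \<open>\<zeta>\<close> counts the zero entries. Unless \<open>{x \<sqinter> y, x \<squnion> y} = {x, y}\<close>, the sum of
  the two squares strictly increases on passing from \<open>x, y\<close> to \<open>x \<sqinter> y, x \<squnion> y\<close>, so a large \<open>C\<close>
  absorbs the bounded contribution of \<open>f\<close>.
\<close>

definition fill :: "nat \<Rightarrow> (nat \<Rightarrow> nat) \<Rightarrow> (nat \<Rightarrow> nat) \<Rightarrow> (nat \<Rightarrow> nat)" where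
  "fill n s z = (\<lambda>i\<in>{1..n}. if s i = 0 then z i else s i)"

definition zeros :: "nat \<Rightarrow> (nat \<Rightarrow> nat) \<Rightarrow> nat set" where
  "zeros n x = {i \<in> {1..n}. x i = 0}"

lemma finite_zeros [simp]: "finite (zeros n x)"
  by (simp add: zeros_def)

lemma mem_cube_iff: "x \<in> cube k n \<longleftrightarrow> x \<in> cube0 k n \<and> zeros n x = {}"
proof -
  have "{1..k} = {0..k} - {0}"
    by auto
  then show ?thesis
    unfolding cube_def cube0_def zeros_def PiE_iff by auto
qed

lemma meet_in_cube0: "x \<in> cube0 k n \<Longrightarrow> y \<in> cube0 k n \<Longrightarrow> meet n x y \<in> cube0 k n"
  by (auto simp: cube0_def meet_def PiE_iff)

lemma join_in_cube0: "x \<in> cube0 k n \<Longrightarrow> y \<in> cube0 k n \<Longrightarrow> join n x y \<in> cube0 k n"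
  by (auto simp: cube0_def join_def PiE_iff)

lemma theta_in_cube:
  "x \<in> cube k n \<Longrightarrow> y \<in> cube k n \<Longrightarrow> z \<in> cube k n \<Longrightarrow> theta n x y z \<in> cube k n"
  by (auto simp: cube_def theta_def theta1_def PiE_iff)

text \<open>Where \<open>x\<close> and \<open>y\<close> agree, joining \<open>z\<close> keeps the
  common entry or cancels it to 0, and the second join restores it. Where they differ,
  \<open>meet\<close> has 0 and the entry of \<open>z\<close> survives both joins.\<close>

lemma theta_eq_join_meet:
  assumes "x \<in> cube k n" "y \<in> cube k n" "z \<in> cube k n"
  shows "theta n x y z = join n (join n (meet n x y) z) (meet n x y)"
proof
  fix i
  show "theta n x y z i = join n (join n (meet n x y) z) (meet n x y) i"
  proof (cases "i \<in> {1..n}")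
    case True
    then have "x i \<ge> 1" "y i \<ge> 1" "z i \<ge> 1"
      using assms by (auto simp: cube_def PiE_iff)
    then show ?thesis
      using True by (auto simp: theta_def theta1_def meet_def join_def)
  qed (auto simp: theta_def join_def)
qed

lemma fill_meet: "fill n (meet n x y) z = theta n (fill n x z) (fill n y z) z"
  by (auto simp: fill_def meet_def theta_def theta1_def)

text \<open>At a conflict of nonzero entries the nested fills differ, so \<open>theta\<close> falls
  back on \<open>z\<close>; elsewhere they agree, since nesting lets a lone nonzero entry win in
  both.\<close>

lemma fill_join:
  "fill n (join n x y) z = theta n (fill n x (fill n y z)) (fill n y (fill n x z)) z"
  by (auto simp: fill_def join_def theta_def theta1_def)

lemma fill_full:
  assumes "x \<in> cube k n"
  shows "fill n x z = x"
proof
  fix i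
  show "fill n x z i = x i"
    using assms by (cases "i \<in> {1..n}") (force simp: fill_def cube_def PiE_iff extensional_def)+
qed

text \<open>This is the comparable case: \<open>y\<close> arises from \<open>x\<close> by erasing
  entries.\<close>

lemma meet_join_trivial:
  assumes x: "x \<in> cube0 k n" and y: "y \<in> cube0 k n"
    and sub: "zeros n x \<subseteq> zeros n y"
    and agree: "\<And>i. i \<in> {1..n} \<Longrightarrow> x i \<noteq> 0 \<Longrightarrow> y i \<noteq> 0 \<Longrightarrow> x i = y i"
  shows "meet n x y = y" and "join n x y = x"
proof -
  have c: "y i = 0 \<or> x i = y i" if "i \<in> {1..n}" for i
    using sub agree[OF that] that by (auto simp: zeros_def)
  have ext: "x i = undefined" "y i = undefined" if "i \<notin> {1..n}" for i
    using x y that by (auto simp: cube0_def PiE_iff extensional_def)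
  show "meet n x y = y" "join n x y = x"
    using c ext by (fastforce simp: meet_def join_def)+
qed

lemma meet_commute: "meet n x y = meet n y x"
  by (auto simp: meet_def)

lemma join_commute: "join n x y = join n y x"
  by (auto simp: join_def)

lemma zeros_square_gain:
  assumes x: "x \<in> cube0 k n" and y: "y \<in> cube0 k n"
  shows "meet n x y = y \<and> join n x y = x \<or> meet n x y = x \<and> join n x y = y \<or>
    (card (zeros n x))\<^sup>2 + (card (zeros n y))\<^sup>2 + 1
      \<le> (card (zeros n (meet n x y)))\<^sup>2 + (card (zeros n (join n x y)))\<^sup>2"
proof -
  define A where "A = zeros n x - zeros n y"
  define B where "B = zeros n y - zeros n x"
  define E where "E = zeros n x \<inter> zeros n y"
  define F where "F = {i \<in> {1..n}. x i \<noteq> 0 \<and> y i \<noteq> 0 \<and> x i \<noteq> y i}"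
  have fin: "finite A" "finite B" "finite E" "finite F"
    by (simp_all add: A_def B_def E_def F_def)
  have "zeros n x = A \<union> E" "zeros n y = B \<union> E"
    by (auto simp: A_def B_def E_def)
  moreover have "zeros n (meet n x y) = A \<union> B \<union> E \<union> F" "zeros n (join n x y) = E \<union> F"
    by (auto simp: zeros_def meet_def join_def A_def B_def E_def F_def split: if_splits)
  moreover have "A \<inter> B = {}" "A \<inter> E = {}" "A \<inter> F = {}" "B \<inter> E = {}" "B \<inter> F = {}" "E \<inter> F = {}"
    by (auto simp: A_def B_def E_def F_def zeros_def)
  ultimately have cards:
    "card (zeros n x) = card A + card E" "card (zeros n y) = card B + card E"
    "card (zeros n (meet n x y)) = card A + card B + card E + card F"
    "card (zeros n (join n x y)) = card E + card F"
    using fin by (simp_all add: card_Un_disjoint Int_Un_distrib2)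
  consider "F = {}" "A = {}" | "F = {}" "B = {}" | "F \<noteq> {} \<or> (A \<noteq> {} \<and> B \<noteq> {})"
    by blast
  then show ?thesis
  proof cases
    case 1
    then have "meet n x y = y" "join n x y = x"
      by (auto intro!: meet_join_trivial[OF x y] simp: A_def F_def)
    then show ?thesis
      by simp
  next
    case 2
    then have "meet n y x = x" "join n y x = y"
      by (auto intro!: meet_join_trivial[OF y x] simp: B_def F_def)
    then show ?thesis
      by (metis meet_commute join_commute)
  next
    case 3
    \<comment> \<open>Either a conflict or zeros missing on each side makes one of the products
      positive; twice this sum is part of the growth of the squares.\<close>
    then have "card F * card F + card A * card B > 0"
      using fin by (auto simp: card_gt_0_iff)
    moreover have "a + 1 \<le> a + 2 * p + q" if "0 < p" for a p q :: nat
      using that by simp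
    moreover have "(card (zeros n (meet n x y)))\<^sup>2 + (card (zeros n (join n x y)))\<^sup>2 =
        (card (zeros n x))\<^sup>2 + (card (zeros n y))\<^sup>2 + 2 * (card F * card F + card A * card B)
        + 2 * card F * (card A + card B + 2 * card E)"
      unfolding cards by (simp add: power2_eq_square algebra_simps)
    ultimately have "(card (zeros n x))\<^sup>2 + (card (zeros n y))\<^sup>2 + 1
        \<le> (card (zeros n (meet n x y)))\<^sup>2 + (card (zeros n (join n x y)))\<^sup>2"
      by presburger
    then show ?thesis
      by blast
  qed
qed

lemma k_submodular_theta_closed:
  assumes sub: "k_submodular k n g"
    and x: "x \<in> cube k n" "g x < \<infinity>" and y: "y \<in> cube k n" "g y < \<infinity>"
    and z: "z \<in> cube k n" "g z < \<infinity>"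
  shows "g (theta n x y z) < \<infinity>"
proof -
  have closed: "g (meet n u v) < \<infinity> \<and> g (join n u v) < \<infinity>"
    if u: "u \<in> cube0 k n" "g u < \<infinity>" and v: "v \<in> cube0 k n" "g v < \<infinity>" for u v
  proof -
    have range: "g w \<noteq> -\<infinity>" if "w \<in> cube0 k n" for w
      using sub that by (force simp: k_submodular_def Rbar_def Pi_iff)
    have "g (meet n u v) + g (join n u v) \<le> g u + g v"
      using sub u v by (simp add: k_submodular_def)
    also have "\<dots> < \<infinity>"
      using u v by simp
    finally show ?thesis
      using range meet_in_cube0[OF u(1) v(1)] join_in_cube0[OF u(1) v(1)] by auto
  qed
  have x0: "x \<in> cube0 k n" and y0: "y \<in> cube0 k n" and z0: "z \<in> cube0 k n"
    using x y z by (simp_all add: mem_cube_iff)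
  note m = meet_in_cube0[OF x0 y0]
  have gm: "g (meet n x y) < \<infinity>"
    using closed[OF x0 x(2) y0 y(2)] by simp
  have "g (join n (meet n x y) z) < \<infinity>"
    using closed[OF m gm z0 z(2)] by simp
  then show ?thesis
    using closed[OF join_in_cube0[OF m z0] _ m gm] theta_eq_join_meet[OF x(1) y(1) z(1)] by simp
qed

text \<open>The four values of \<open>r\<close> differ by at most \<open>4 * M\<close> in total,
  which a growth of the squares by 1 compensates.\<close>

lemma k_submodular_penalised:
  fixes r :: "(nat \<Rightarrow> nat) \<Rightarrow> real"
  assumes S: "S \<subseteq> cube0 k n"
    and closed: "\<And>x y. x \<in> S \<Longrightarrow> y \<in> S \<Longrightarrow> meet n x y \<in> S \<and> join n x y \<in> S"
    and bound: "\<And>x. x \<in> S \<Longrightarrow> \<bar>r x\<bar> \<le> M"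
  shows "k_submodular k n
    (\<lambda>x. if x \<in> S then ereal (r x - 4 * M * (real (card (zeros n x)))\<^sup>2) else \<infinity>)"
    (is "k_submodular k n ?g")
  unfolding k_submodular_def
proof (intro conjI ballI)
  show "?g \<in> cube0 k n \<rightarrow> Rbar"
    by (auto simp: Rbar_def)
next
  fix x y assume x: "x \<in> cube0 k n" and y: "y \<in> cube0 k n"
  let ?m = "meet n x y" and ?j = "join n x y" and ?q = "\<lambda>x. (card (zeros n x))\<^sup>2"
  show "?g ?m + ?g ?j \<le> ?g x + ?g y"
  proof (cases "x \<in> S \<and> y \<in> S")
    case True
    then have mj: "?m \<in> S" "?j \<in> S"
      using closed by auto
    have b: "\<bar>r x\<bar> \<le> M" "\<bar>r y\<bar> \<le> M" "\<bar>r ?m\<bar> \<le> M" "\<bar>r ?j\<bar> \<le> M"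
      using True mj bound by auto
    then have M: "0 \<le> M"
      by linarith
    consider "?m = y \<and> ?j = x" | "?m = x \<and> ?j = y" | "?q x + ?q y + 1 \<le> ?q ?m + ?q ?j"
      using zeros_square_gain[OF x y] by blast
    then show ?thesis
    proof cases
      case 3
      then have "real (?q x) + real (?q y) + 1 \<le> real (?q ?m) + real (?q ?j)"
        by linarith
      then have "4 * M * (real (?q x) + real (?q y) + 1) \<le> 4 * M * (real (?q ?m) + real (?q ?j))"
        using M by (intro mult_left_mono) auto
      then show ?thesis
        using True mj b by (simp add: algebra_simps)
    qed (simp_all add: add.commute)
  qed auto
qed

theorem theorem1:
  fixes k n :: nat and f :: "(nat \<Rightarrow> nat) \<Rightarrow> ereal"
  assumes "k \<ge> 1" and "n \<ge> 1"
    and "f \<in> cube k n \<rightarrow> Rbar"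
  shows "(\<exists>g. k_submodular_relaxation k n f g) \<longleftrightarrow>
    (\<forall>x\<in>eff_dom k n f. \<forall>y\<in>eff_dom k n f. \<forall>z\<in>eff_dom k n f. theta n x y z \<in> eff_dom k n f)"
proof
  assume "\<exists>g. k_submodular_relaxation k n f g"
  then obtain g where "k_submodular k n g" "\<And>x. x \<in> cube k n \<Longrightarrow> g x = f x"
    by (auto simp: k_submodular_relaxation_def)
  then show "\<forall>x\<in>eff_dom k n f. \<forall>y\<in>eff_dom k n f. \<forall>z\<in>eff_dom k n f. theta n x y z \<in> eff_dom k n f"
    using k_submodular_theta_closed[of k n g] theta_in_cube[of _ k n] by (auto simp: eff_dom_def)
next
  define D where "D = eff_dom k n f"
  assume "\<forall>x\<in>eff_dom k n f. \<forall>y\<in>eff_dom k n f. \<forall>z\<in>eff_dom k n f. theta n x y z \<in> eff_dom k n f"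
  then have theta: "\<And>x y z. x \<in> D \<Longrightarrow> y \<in> D \<Longrightarrow> z \<in> D \<Longrightarrow> theta n x y z \<in> D"
    by (simp add: D_def)
  have D_cube: "D \<subseteq> cube k n"
    by (auto simp: D_def eff_dom_def)
  have "finite (cube k n)"
    unfolding cube_def by (intro finite_PiE) auto
  then have finD: "finite D"
    using D_cube finite_subset by blast
  \<comment> \<open>The conjunct \<open>D \<noteq> {}\<close> makes \<open>S\<close> empty when \<open>D\<close> is; without it \<open>S\<close> would be everything.\<close>
  define S where "S = {s \<in> cube0 k n. D \<noteq> {} \<and> (\<forall>z\<in>D. fill n s z \<in> D)}"
  define r where "r x = (if x \<in> D then real_of_ereal (f x) else 0)" for x
  \<comment> \<open>A crude uniform bound, as \<open>D\<close> is finite and \<open>r\<close>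
    vanishes off \<open>D\<close>.\<close>
  define M where "M = (\<Sum>x\<in>D. \<bar>r x\<bar>)"
  let ?g = "\<lambda>x. if x \<in> S then ereal (r x - 4 * M * (real (card (zeros n x)))\<^sup>2) else \<infinity>"
  have "M \<ge> 0"
    unfolding M_def by (intro sum_nonneg) auto
  then have bound: "\<bar>r x\<bar> \<le> M" for x
  proof (cases "x \<in> D")
    case True
    then show ?thesis
      unfolding M_def using finD by (intro member_le_sum) auto
  qed (simp add: r_def)
  have "meet n x y \<in> S \<and> join n x y \<in> S" if "x \<in> S" "y \<in> S" for x y
    using that theta by (auto simp: S_def fill_meet fill_join meet_in_cube0 join_in_cube0)
  then have "k_submodular k n ?g"
    using bound by (intro k_submodular_penalised) (auto simp: S_def)
  moreover have "?g x = f x" if x: "x \<in> cube k n" for x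
  proof -
    \<comment> \<open>Filling any \<open>z\<close> in the nonempty \<open>D\<close> returns
      \<open>x\<close> itself; conversely, \<open>x\<close> witnesses that \<open>D\<close> is
      nonempty.\<close>
    have "x \<in> S \<longleftrightarrow> x \<in> D"
      using x fill_full[OF x] by (auto simp: S_def mem_cube_iff)
    moreover have "f x \<in> Rbar"
      using assms(3) x by auto
    \<comment> \<open>The penalty vanishes because \<open>x\<close> has no zero entries.\<close>
    ultimately show ?thesis
      using x by (cases "f x") (auto simp: r_def D_def eff_dom_def Rbar_def mem_cube_iff)
  qed
  ultimately show "\<exists>g. k_submodular_relaxation k n f g"
    unfolding k_submodular_relaxation_def by blast
qed

end
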